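(* Let $(X,d)$ be a complete $\mathrm{CAT}(0)$ space. If $K\subseteq X$ is compact, then $\operatorname{thr}^nK$ is compact for all $n\in\mathbb N$.
   Context: A $\mathrm{CAT}(0)$ space is a geodesic metric space in which every geodesic triangle is at least as thin as its Euclidean comparison triangle; it is uniquely geodesic, and $[x,y]$ denotes the geodesic segment joining $x$ and $y$. The threading of $S\subseteq X$ is $\operatorname{thr}S:=\bigcup_{x,y\in S}[x,y]$, and iteratively $\operatorname{thr}^1S=\operatorname{thr}S$, $\operatorname{thr}^nS=\operatorname{thr}(\operatorname{thr}^{n-1}S)$; $\mathbb N=\{1,2,\dots\}$. *)

theory Defs
  imports "HOL-Analysis.Analysis"
begin

text \<open>
  A metric space \<open>(X, d)\<close> is represented by a set \<open>X\<close> in a type of class \<open>metric_space\<close>, with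
  \<open>d\<close> the restriction of \<open>dist\<close>. Geodesics are required to stay inside \<open>X\<close>, so all notions
  below are intrinsic to \<open>X\<close>.
\<close>

definition geodesic_path :: "'a::metric_space set \<Rightarrow> 'a \<Rightarrow> 'a \<Rightarrow> (real \<Rightarrow> 'a) \<Rightarrow> bool" where
  "geodesic_path X x y c \<longleftrightarrow>
     c ` {0..dist x y} \<subseteq> X \<and> c 0 = x \<and> c (dist x y) = y \<and>
     (\<forall>s\<in>{0..dist x y}. \<forall>t\<in>{0..dist x y}. dist (c s) (c t) = \<bar>s - t\<bar>)"

definition geodesic_segment :: "'a::metric_space set \<Rightarrow> 'a \<Rightarrow> 'a \<Rightarrow> 'a set \<Rightarrow> bool" where
  "geodesic_segment X x y S \<longleftrightarrow> (\<exists>c. geodesic_path X x y c \<and> S = c ` {0..dist x y})"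

definition geodesic_space :: "'a::metric_space set \<Rightarrow> bool" where
  "geodesic_space X \<longleftrightarrow> (\<forall>x\<in>X. \<forall>y\<in>X. \<exists>S. geodesic_segment X x y S)"

definition geodesic_triangle ::
    "'a::metric_space set \<Rightarrow> 'a \<Rightarrow> 'a \<Rightarrow> 'a \<Rightarrow> 'a set \<Rightarrow> 'a set \<Rightarrow> 'a set \<Rightarrow> bool" where
  "geodesic_triangle X p q r A B C \<longleftrightarrow>
     p \<in> X \<and> q \<in> X \<and> r \<in> X \<and>
     geodesic_segment X p q A \<and> geodesic_segment X q r B \<and> geodesic_segment X r p C"

definition comparison_triangle ::
    "'a::metric_space \<Rightarrow> 'a \<Rightarrow> 'a \<Rightarrow> real^2 \<Rightarrow> real^2 \<Rightarrow> real^2 \<Rightarrow> bool" where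
  "comparison_triangle p q r p' q' r' \<longleftrightarrow>
     dist p' q' = dist p q \<and> dist q' r' = dist q r \<and> dist r' p' = dist r p"

text \<open>
  \<open>a'\<close> is the comparison point on \<open>[p', q']\<close> of the point \<open>a\<close> on the side \<open>A\<close> from \<open>p\<close> to \<open>q\<close>.
\<close>

definition comparison_point ::
    "'a::metric_space \<Rightarrow> 'a set \<Rightarrow> real^2 \<Rightarrow> real^2 \<Rightarrow> 'a \<Rightarrow> real^2 \<Rightarrow> bool" where
  "comparison_point p A p' q' a a' \<longleftrightarrow>
     a \<in> A \<and> a' \<in> closed_segment p' q' \<and> dist p' a' = dist p a"

text \<open>
  The comparison triangle exists and is unique up to isometry of the plane, so quantifying over all
  comparison triangles is the same as fixing one.
\<close>

definition CAT0_space :: "'a::metric_space set \<Rightarrow> bool" where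
  "CAT0_space X \<longleftrightarrow> geodesic_space X \<and>
     (\<forall>p q r A B C p' q' r' a b a' b'.
        geodesic_triangle X p q r A B C \<longrightarrow>
        comparison_triangle p q r p' q' r' \<longrightarrow>
        comparison_point p A p' q' a a' \<or> comparison_point q B q' r' a a' \<or>
          comparison_point r C r' p' a a' \<longrightarrow>
        comparison_point p A p' q' b b' \<or> comparison_point q B q' r' b b' \<or>
          comparison_point r C r' p' b b' \<longrightarrow>
        dist a b \<le> dist a' b')"

text \<open>The segment \<open>[x, y]\<close>; only meaningful when the geodesic segment is unique.\<close>

definition geodesic_seg :: "'a::metric_space set \<Rightarrow> 'a \<Rightarrow> 'a \<Rightarrow> 'a set" where
  "geodesic_seg X x y = (THE S. geodesic_segment X x y S)"

definition thr :: "'a::metric_space set \<Rightarrow> 'a set \<Rightarrow> 'a set" where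
  "thr X S = (\<Union>x\<in>S. \<Union>y\<in>S. geodesic_seg X x y)"

lemma geodesic_segment_subset_CAT0:
  assumes X: "CAT0_space X" and xy: "x \<in> X" "y \<in> X"
    and S: "geodesic_segment X x y S" and T: "geodesic_segment X x y T"
  shows "S \<subseteq> T"
proof
  fix a assume "a \<in> S"
  from S obtain c where c: "geodesic_path X x y c" "S = c ` {0..dist x y}"
    unfolding geodesic_segment_def by blast
  from T obtain e where e: "geodesic_path X x y e" "T = e ` {0..dist x y}"
    unfolding geodesic_segment_def by blast
  from \<open>a \<in> S\<close> c obtain t where t: "t \<in> {0..dist x y}" "a = c t" by blast
  define u :: "real^2" where "u = axis 1 1"
  have u: "norm u = 1" by (simp add: u_def)
  let ?l = "dist x y"
  have B: "geodesic_segment X x x {x}"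
    unfolding geodesic_segment_def geodesic_path_def using xy by (intro exI[of _ "\<lambda>_. x"]) auto
  have C: "geodesic_segment X y x T"
    unfolding geodesic_segment_def geodesic_path_def
  proof (intro exI[of _ "\<lambda>s. e (?l - s)"] conjI)
    have "(\<lambda>s. ?l - s) ` {0..?l} = {0..?l}" by simp
    then have img: "(\<lambda>s. e (?l - s)) ` {0..?l} = e ` {0..?l}" by (metis image_image)
    show "(\<lambda>s. e (?l - s)) ` {0..dist y x} \<subseteq> X" "T = (\<lambda>s. e (?l - s)) ` {0..dist y x}"
      using img e by (auto simp: geodesic_path_def dist_commute)
  qed (use e in \<open>auto simp: geodesic_path_def dist_commute\<close>)
  have tri: "geodesic_triangle X x x y {x} S T"
    unfolding geodesic_triangle_def using xy B S C by blast
  have cmp: "comparison_triangle x x y 0 0 (?l *\<^sub>R u)"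
    unfolding comparison_triangle_def by (simp add: u dist_norm dist_commute norm_minus_commute)
  have seg: "t *\<^sub>R u \<in> closed_segment 0 (?l *\<^sub>R u)"
  proof (cases "?l = 0")
    case False
    then show ?thesis using t unfolding closed_segment_def
      by (auto intro!: exI[of _ "t / ?l"] simp: divide_simps)
  qed (use t in auto)
  have "dist (c 0) (c t) = t" "dist (e ?l) (e t) = ?l - t"
    using c(1) e(1) t(1) unfolding geodesic_path_def
    by (smt (verit) atLeastAtMost_iff zero_le_dist)+
  then have d: "dist x a = t" "dist y (e t) = ?l - t"
    using c(1) e(1) t(2) unfolding geodesic_path_def by auto
  have 1: "comparison_point x S 0 (?l *\<^sub>R u) a (t *\<^sub>R u)"
    unfolding comparison_point_def using \<open>a \<in> S\<close> seg d t by (simp add: u)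
  have "dist (?l *\<^sub>R u) (t *\<^sub>R u) = ?l - t"
    using t by (simp add: u dist_norm flip: scaleR_diff_left)
  then have 2: "comparison_point y T (?l *\<^sub>R u) 0 (e t) (t *\<^sub>R u)"
    unfolding comparison_point_def using e t seg d by (simp add: closed_segment_commute)
  have "dist a (e t) \<le> dist (t *\<^sub>R u) (t *\<^sub>R u)"
    using X tri cmp 1 2 unfolding CAT0_space_def by blast
  then have "a = e t" by simp
  then show "a \<in> T" using e t by blast
qed

lemma geodesic_seg_CAT0:
  assumes "CAT0_space X" "x \<in> X" "y \<in> X"
  shows "geodesic_segment X x y S \<longleftrightarrow> S = geodesic_seg X x y"
proof -
  have "\<exists>!S. geodesic_segment X x y S"
    using assms geodesic_segment_subset_CAT0[OF assms]
    unfolding CAT0_space_def geodesic_space_def by blast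
  then show ?thesis unfolding geodesic_seg_def by (metis theI')
qed

end

theory Submission
  imports Defs
begin

text \<open>
  Comparing the triangles \<open>x, y, y'\<close> and \<open>y', x, x'\<close> with Euclidean ones shows that the point
  dividing \<open>[x, y]\<close> in the ratio \<open>t : 1 - t\<close> depends continuously on \<open>(x, y, t)\<close>. Hence
  \<open>thr S\<close> is the continuous image of the compact set \<open>S \<times> S \<times> [0, 1]\<close>.
\<close>

text \<open>The inequality in \<open>CAT0_space\<close> is stated for every comparison triangle, so
  it says nothing until one is exhibited. Put \<open>p\<close> at the origin and \<open>q\<close> on
  the first axis; the triangle inequalities guarantee a third vertex at the two prescribed
  distances.\<close>

lemma comparison_triangle_exists:
  fixes p q r :: "'a::metric_space"
  obtains p' q' r' where "comparison_triangle p q r p' q' r'"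
proof (cases "p = q")
  case True
  \<comment> \<open>With \<open>p = q\<close> two vertices coincide and any vector of length
    \<open>dist p r\<close> serves as the third; the formula for \<open>u\<close> below would divide
    by zero here.\<close>
  have "comparison_triangle p q r 0 0 (dist p r *\<^sub>R axis 1 1)"
    by (simp add: comparison_triangle_def True dist_commute)
  then show ?thesis by (rule that)
next
  case False
  define a b c where "a = dist p q" and "b = dist q r" and "c = dist r p"
  have a: "a > 0" and nonneg: "b \<ge> 0" "c \<ge> 0"
    using False by (auto simp: a_def b_def c_def)
  have tri: "a \<le> b + c" "b \<le> a + c" "c \<le> a + b"
    unfolding a_def b_def c_def by metric+
  \<comment> \<open>Law of cosines: subtracting
    \<open>(a - u)\<^sup>2 + v\<^sup>2 = b\<^sup>2\<close> from
    \<open>u\<^sup>2 + v\<^sup>2 = c\<^sup>2\<close> leaves a linear equation for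
    \<open>u\<close>.\<close>
  define u where "u = (a\<^sup>2 + c\<^sup>2 - b\<^sup>2) / (2 * a)"
  define v where "v = sqrt (c\<^sup>2 - u\<^sup>2)"
  have au: "2 * a * u = a\<^sup>2 + c\<^sup>2 - b\<^sup>2" using a by (simp add: u_def)
  \<comment> \<open>These two bounds on \<open>b\<close> amount to -c \<le> u \<le> c, so the
    radicand in \<open>v\<close> is nonnegative and \<open>v\<close> really squares to it.\<close>
  have "b\<^sup>2 \<le> (a + c)\<^sup>2" using tri nonneg by (intro power_mono) auto
  moreover have "(a - c)\<^sup>2 \<le> b\<^sup>2" using tri nonneg by (auto simp: power2_le_iff_abs_le)
  ultimately have "2 * a * u \<le> 2 * a * c" "2 * a * (- u) \<le> 2 * a * c"
    using au by (simp_all add: power2_sum power2_diff)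
  then have "u \<le> c" "- u \<le> c"
    using mult_le_cancel_left_pos[of "2 * a"] a by (blast intro: mult_pos_pos zero_less_numeral)+
  then have "\<bar>u\<bar> \<le> c" by simp
  then have "u\<^sup>2 \<le> c\<^sup>2" using a nonneg by (simp add: power2_le_iff_abs_le)
  then have v: "v\<^sup>2 = c\<^sup>2 - u\<^sup>2" by (simp add: v_def)
  have "dist (vector [a, 0] :: real^2) (vector [u, v]) = sqrt ((a - u)\<^sup>2 + v\<^sup>2)"
    by (simp add: dist_vec_def L2_set_def sum_2 dist_real_def)
  also have "(a - u)\<^sup>2 + v\<^sup>2 = b\<^sup>2" using v au by (simp add: power2_diff)
  finally have "dist (vector [a, 0] :: real^2) (vector [u, v]) = b" using nonneg by simp
  moreover have "dist (vector [u, v] :: real^2) 0 = c"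
    using v nonneg by (simp add: dist_vec_def L2_set_def sum_2 dist_real_def)
  moreover have "dist (0 :: real^2) (vector [a, 0]) = a"
    using a by (simp add: dist_vec_def L2_set_def sum_2 dist_real_def)
  ultimately have "comparison_triangle p q r 0 (vector [a, 0]) (vector [u, v])"
    by (simp add: comparison_triangle_def a_def b_def c_def)
  then show ?thesis by (rule that)
qed

lemma geodesic_segment_sym:
  assumes "geodesic_segment X x y S"
  shows "geodesic_segment X y x S"
proof -
  obtain c where c: "geodesic_path X x y c" "S = c ` {0..dist x y}"
    using assms unfolding geodesic_segment_def by blast
  have "(\<lambda>s. dist x y - s) ` {0..dist x y} = {0..dist x y}" by simp
  then have img: "(\<lambda>s. c (dist x y - s)) ` {0..dist x y} = c ` {0..dist x y}"
    by (metis image_image)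
  show ?thesis
    unfolding geodesic_segment_def geodesic_path_def
    by (rule exI[of _ "\<lambda>s. c (dist x y - s)"])
      (use img c in \<open>auto simp: geodesic_path_def dist_commute\<close>)
qed

text \<open>For \<open>x = y\<close> the value of \<open>t\<close> is immaterial.\<close>

definition at_ratio :: "'a::metric_space set \<Rightarrow> 'a \<Rightarrow> 'a \<Rightarrow> real \<Rightarrow> 'a \<Rightarrow> bool" where
  "at_ratio X x y t z \<longleftrightarrow>
     z \<in> geodesic_seg X x y \<and> dist x z = t * dist x y \<and> dist z y = (1 - t) * dist x y"

context
  fixes X :: "'a::metric_space set"
  assumes CAT0: "CAT0_space X"
begin

lemma geodesic_segment_geodesic_seg:
  "x \<in> X \<Longrightarrow> y \<in> X \<Longrightarrow> geodesic_segment X x y (geodesic_seg X x y)"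
  using geodesic_seg_CAT0[OF CAT0] by blast

lemma geodesic_seg_sym:
  "x \<in> X \<Longrightarrow> y \<in> X \<Longrightarrow> geodesic_seg X y x = geodesic_seg X x y"
  using geodesic_segment_sym[OF geodesic_segment_geodesic_seg] geodesic_seg_CAT0[OF CAT0] by blast

lemma geodesic_seg_path:
  assumes "x \<in> X" "y \<in> X"
  obtains c where "geodesic_path X x y c" "geodesic_seg X x y = c ` {0..dist x y}"
  using geodesic_segment_geodesic_seg[OF assms] unfolding geodesic_segment_def by blast

lemma geodesic_path_dist:
  assumes "geodesic_path X x y c" "s \<in> {0..dist x y}"
  shows "dist x (c s) = s" "dist (c s) y = dist x y - s"
proof -
  have *: "0 \<in> {0..dist x y}" "dist x y \<in> {0..dist x y}" by auto
  have "dist (c 0) (c s) = \<bar>0 - s\<bar>" "dist (c s) (c (dist x y)) = \<bar>s - dist x y\<bar>"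
    using assms * unfolding geodesic_path_def by blast+
  then show "dist x (c s) = s" "dist (c s) y = dist x y - s"
    using assms unfolding geodesic_path_def by auto
qed

lemma geodesic_seg_subset: "x \<in> X \<Longrightarrow> y \<in> X \<Longrightarrow> geodesic_seg X x y \<subseteq> X"
  by (metis geodesic_seg_path geodesic_path_def)

lemma at_ratio_exists:
  assumes "x \<in> X" "y \<in> X" "t \<in> {0..1}"
  shows "\<exists>z. at_ratio X x y t z"
proof -
  obtain c where c: "geodesic_path X x y c" "geodesic_seg X x y = c ` {0..dist x y}"
    using geodesic_seg_path assms by blast
  have "t * dist x y \<in> {0..dist x y}"
    using assms by (auto simp: mult_left_le_one_le)
  with geodesic_path_dist[OF c(1) this] c(2) have "at_ratio X x y t (c (t * dist x y))"
    unfolding at_ratio_def by (auto simp: algebra_simps)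
  then show ?thesis by blast
qed

lemma geodesic_seg_at_ratio:
  assumes "x \<in> X" "y \<in> X" "z \<in> geodesic_seg X x y"
  obtains t where "t \<in> {0..1}" "at_ratio X x y t z"
proof -
  obtain c where c: "geodesic_path X x y c" "geodesic_seg X x y = c ` {0..dist x y}"
    using geodesic_seg_path assms by blast
  then obtain s where s: "s \<in> {0..dist x y}" "z = c s" using assms by blast
  note d = geodesic_path_dist[OF c(1) s(1), folded s(2)]
  show thesis
  proof (rule that)
    \<comment> \<open>For \<open>x = y\<close> the quotient is 0 by the convention on division by
      zero, an admissible ratio since all distances involved vanish.\<close>
    show "s / dist x y \<in> {0..1}"
      using s(1) by (cases "x = y") (auto simp: divide_le_eq_1)
    show "at_ratio X x y (s / dist x y) z"
      using assms(3) d s(1) unfolding at_ratio_def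
      by (cases "x = y") (simp_all add: left_diff_distrib)
  qed
qed

lemma at_ratio_sym:
  "x \<in> X \<Longrightarrow> y \<in> X \<Longrightarrow> at_ratio X x y t z \<Longrightarrow> at_ratio X y x (1 - t) z"
  unfolding at_ratio_def by (simp add: geodesic_seg_sym dist_commute)

text \<open>In the plane, the points at ratio \<open>t\<close> on two sides issuing from one vertex
  are exactly \<open>t\<close> times the opposite side apart (intercept theorem). The CAT(0)
  inequality carries this over as an upper bound.\<close>

lemma at_ratio_dist_right:
  assumes X: "x \<in> X" "y \<in> X" "y' \<in> X" and t: "t \<in> {0..1}"
    and z: "at_ratio X x y t z" and w: "at_ratio X x y' t w"
  shows "dist z w \<le> t * dist y y'"
proof -
  obtain p q r where cmp: "comparison_triangle x y y' p q r"
    by (rule comparison_triangle_exists)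
  then have pqr: "dist p q = dist x y" "dist q r = dist y y'" "dist r p = dist y' x"
    unfolding comparison_triangle_def by auto
  have tri: "geodesic_triangle X x y y' (geodesic_seg X x y) (geodesic_seg X y y')
      (geodesic_seg X y' x)"
    unfolding geodesic_triangle_def using X geodesic_segment_geodesic_seg by blast
  define z' w' where "z' = p + t *\<^sub>R (q - p)" and "w' = p + t *\<^sub>R (r - p)"
  have "z' \<in> closed_segment p q" "w' \<in> closed_segment p r"
    unfolding z'_def w'_def closed_segment_def using t
    by (auto intro!: exI[of _ t] simp: algebra_simps)
  moreover have "dist p z' = dist x z"
    using z t pqr(1) unfolding at_ratio_def z'_def
    by (simp add: dist_norm norm_minus_commute)
  \<comment> \<open>The third side of the triangle runs from \<open>y'\<close> to \<open>x\<close>,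
    so the comparison point of \<open>w\<close> is measured from \<open>r\<close>, where its ratio
    is \<open>1 - t\<close>.\<close>
  moreover have "dist r w' = dist y' w"
  proof -
    have "r - w' = (1 - t) *\<^sub>R (r - p)" by (simp add: w'_def algebra_simps)
    then have "dist r w' = (1 - t) * dist r p"
      using t by (simp add: dist_norm)
    then show ?thesis using w pqr(3) unfolding at_ratio_def by (simp add: dist_commute)
  qed
  ultimately have "comparison_point x (geodesic_seg X x y) p q z z'"
    "comparison_point y' (geodesic_seg X y' x) r p w w'"
    using z w X unfolding comparison_point_def at_ratio_def
    by (simp_all add: geodesic_seg_sym closed_segment_commute)
  then have "dist z w \<le> dist z' w'"
    using CAT0 tri cmp unfolding CAT0_space_def by blast
  also have "z' - w' = t *\<^sub>R (q - r)" by (simp add: z'_def w'_def algebra_simps)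
  then have "dist z' w' = t * dist q r" using t by (simp add: dist_norm)
  finally show ?thesis using pqr by simp
qed

text \<open>Reversing both segments makes \<open>y\<close> the common starting vertex and turns
  \<open>t\<close> into \<open>1 - t\<close>.\<close>

lemma at_ratio_dist_left:
  assumes "x \<in> X" "x' \<in> X" "y \<in> X" and "t \<in> {0..1}"
    and "at_ratio X x y t z" and "at_ratio X x' y t w"
  shows "dist z w \<le> (1 - t) * dist x x'"
  by (rule at_ratio_dist_right[of y x x']) (use assms at_ratio_sym in auto)

text \<open>Both points lie on a single path parametrised by arc length. The case
  \<open>s = t\<close> shows that the ratio determines the point.\<close>

lemma at_ratio_dist_param:
  assumes X: "x \<in> X" "y \<in> X" and z: "at_ratio X x y s z" and w: "at_ratio X x y t w"
  shows "dist z w = \<bar>s - t\<bar> * dist x y"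
proof -
  obtain c where c: "geodesic_path X x y c" "geodesic_seg X x y = c ` {0..dist x y}"
    using geodesic_seg_path X by blast
  obtain a b where ab: "a \<in> {0..dist x y}" "b \<in> {0..dist x y}" "z = c a" "w = c b"
    using z w c(2) unfolding at_ratio_def by blast
  have "a = s * dist x y" "b = t * dist x y"
    using geodesic_path_dist(1)[OF c(1)] ab z w unfolding at_ratio_def by auto
  moreover have "dist z w = \<bar>a - b\<bar>"
    using c(1) ab unfolding geodesic_path_def by blast
  ultimately show ?thesis by (simp add: abs_mult flip: left_diff_distrib)
qed

text \<open>Go from \<open>z\<close> to \<open>w\<close> by changing one datum at a time: first
  \<open>y\<close> to \<open>y'\<close>, then \<open>x\<close> to \<open>x'\<close>, each at ratio
  \<open>s\<close>, and finally \<open>s\<close> to \<open>t\<close> along the segment from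
  \<open>x'\<close> to \<open>y'\<close>.\<close>

lemma at_ratio_dist:
  assumes X: "x \<in> X" "y \<in> X" "x' \<in> X" "y' \<in> X" and t: "s \<in> {0..1}" "t \<in> {0..1}"
    and z: "at_ratio X x y s z" and w: "at_ratio X x' y' t w"
  shows "dist z w \<le> dist x x' + dist y y' + \<bar>s - t\<bar> * dist x' y'"
proof -
  obtain v where v: "at_ratio X x y' s v" using at_ratio_exists X t by blast
  obtain u where u: "at_ratio X x' y' s u" using at_ratio_exists X t by blast
  have "dist z v \<le> s * dist y y'" using at_ratio_dist_right z v X t by blast
  also have "\<dots> \<le> dist y y'" using t by (auto simp: mult_left_le_one_le)
  finally have 1: "dist z v \<le> dist y y'" .
  have "dist v u \<le> (1 - s) * dist x x'" using at_ratio_dist_left v u X t by blast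
  also have "\<dots> \<le> dist x x'" using t by (auto simp: mult_left_le_one_le)
  finally have 2: "dist v u \<le> dist x x'" .
  have "dist u w = \<bar>s - t\<bar> * dist x' y'" using at_ratio_dist_param u w X by blast
  then show ?thesis using 1 2 dist_triangle[of z w v] dist_triangle[of v w u] by linarith
qed

lemma compact_thr:
  assumes S: "S \<subseteq> X" "compact S"
  shows "compact (thr X S)"
proof -
  \<comment> \<open>On \<open>?D\<close> the choice is forced: a point at the given ratio exists,
    and by \<open>at_ratio_dist_param\<close> there is only one.\<close>
  define f where "f = (\<lambda>(x, y, t). SOME z. at_ratio X x y t z)"
  let ?D = "S \<times> S \<times> {0..1::real}"
  have f: "at_ratio X x y t (f (x, y, t))" if "(x, y, t) \<in> ?D" for x y t
    using at_ratio_exists[of x y t] that S(1) unfolding f_def by (auto intro: someI_ex)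
  have "(f \<longlongrightarrow> f p) (at p within ?D)" if p: "p \<in> ?D" for p
  proof -
    \<comment> \<open>This is the bound of \<open>at_ratio_dist\<close> with the fixed triple
      \<open>p\<close> in second place. The length multiplying the ratio difference is thus
      constant, and \<open>g\<close> tends to \<open>g p = 0\<close>.\<close>
    define g where "g = (\<lambda>q. dist (fst q) (fst p) + dist (fst (snd q)) (fst (snd p))
      + \<bar>snd (snd q) - snd (snd p)\<bar> * dist (fst p) (fst (snd p)))"
    have "(g \<longlongrightarrow> g p) (at p within ?D)"
      unfolding g_def by (intro tendsto_intros)
    then have "(g \<longlongrightarrow> 0) (at p within ?D)" by (simp add: g_def)
    moreover have "dist (f q) (f p) \<le> g q" if "q \<in> ?D" for q
      unfolding g_def using p that S(1)
      by (cases p; cases q) (auto intro!: at_ratio_dist f)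
    then have "\<forall>\<^sub>F q in at p within ?D. norm (dist (f q) (f p)) \<le> g q"
      by (simp add: eventually_at_filter)
    ultimately have "((\<lambda>q. dist (f q) (f p)) \<longlongrightarrow> 0) (at p within ?D)"
      by (rule Lim_null_comparison[rotated])
    then show ?thesis by (rule tendsto_dist_iff[THEN iffD2])
  qed
  then have "continuous_on ?D f" unfolding continuous_on_def by blast
  then have "compact (f ` ?D)"
    by (intro compact_continuous_image compact_Times S compact_Icc)
  also have "f ` ?D = thr X S"
  proof (intro equalityI subsetI)
    fix z assume "z \<in> f ` ?D"
    then obtain x y t where "(x, y, t) \<in> ?D" "z = f (x, y, t)" by auto
    with f[of x y t] show "z \<in> thr X S" unfolding thr_def at_ratio_def by blast
  next
    fix z assume "z \<in> thr X S"
    then obtain x y where xy: "x \<in> S" "y \<in> S" "z \<in> geodesic_seg X x y"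
      unfolding thr_def by blast
    then have X: "x \<in> X" "y \<in> X" using S by auto
    obtain t where t: "t \<in> {0..1}" "at_ratio X x y t z"
      using geodesic_seg_at_ratio[OF X xy(3)] .
    \<comment> \<open>Uniqueness at equal ratios: the given point and the chosen one are at distance
      zero.\<close>
    have "dist z (f (x, y, t)) = \<bar>t - t\<bar> * dist x y"
      by (rule at_ratio_dist_param) (use X t xy f in auto)
    then have "z = f (x, y, t)" by simp
    then show "z \<in> f ` ?D" using xy t by blast
  qed
  finally show ?thesis .
qed

lemma thr_subset: "S \<subseteq> X \<Longrightarrow> thr X S \<subseteq> X"
  unfolding thr_def using geodesic_seg_subset by blast

end

theorem theorem4:
  fixes X K :: "'a::metric_space set" and n :: nat
  assumes "CAT0_space X" and "complete X"
    and "K \<subseteq> X" and "compact K"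
    and "n \<ge> 1"
  shows "compact ((thr X ^^ n) K)"
proof -
  \<comment> \<open>Inclusion in \<open>X\<close> is carried through the induction because
    \<open>compact_thr\<close> demands it of the set being threaded.\<close>
  have "(thr X ^^ n) K \<subseteq> X \<and> compact ((thr X ^^ n) K)"
  proof (induction n)
    case (Suc n)
    then show ?case using compact_thr thr_subset assms(1) by (metis comp_apply funpow.simps(2))
  qed (use assms in simp)
  then show ?thesis ..
qed

end
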